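(* The logic $\mathrm{BL}_{\mathrm{Chang}}$ is not strongly complete with respect to $\omega\mathcal V$.
   Context: **BL-algebras.** A BL-algebra is $\mathcal A=\langle A,*,\Rightarrow,\sqcap,\sqcup,0,1\rangle$ such that $\langle A,\sqcap,\sqcup,0,1\rangle$ is a bounded lattice, $\langle A,*,1\rangle$ is a commutative monoid, $z*x\le y$ iff $z\le x\Rightarrow y$, and $(x\Rightarrow y)\sqcup(y\Rightarrow x)=1$, $x\sqcap y=x*(x\Rightarrow y)$. MV-algebras are the BL-algebras satisfying $x=(x\Rightarrow0)\Rightarrow0$. **Logic.** Formulas are built from a denumerable set $VAR$ of variables with $\&,\to,\bot$. Derived connectives: $\neg\varphi=\varphi\to\bot$, $\varphi\land\psi=\varphi\&(\varphi\to\psi)$, $\varphi\leftrightarrow\psi=(\varphi\to\psi)\&(\psi\to\varphi)$, $\varphi^2=\varphi\&\varphi$, and $\varphi\veebar\psi=((\varphi\to(\varphi\&\psi))\to\psi)\land((\psi\to(\varphi\&\psi))\to\varphi)$, $\overline 2\varphi=\varphi\veebar\varphi$. BL has modus ponens as only rule and axioms: $(\varphi\to\psi)\to((\psi\to\chi)\to(\varphi\to\chi))$; $(\varphi\&\psi)\to\varphi$; $(\varphi\&\psi)\to(\psi\&\varphi)$; $(\varphi\&(\varphi\to\psi))\to(\psi\&(\psi\to\varphi))$; $(\varphi\to(\psi\to\chi))\to((\varphi\&\psi)\to\chi)$; $((\varphi\&\psi)\to\chi)\to(\varphi\to(\psi\to\chi))$; $((\varphi\to\psi)\to\chi)\to(((\psi\to\varphi)\to\chi)\to\chi)$;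 $\bot\to\varphi$. $\mathrm{BL}_{\mathrm{Chang}}$ is BL plus the axiom schema $(\overline2\varphi)^2\leftrightarrow\overline2(\varphi^2)$. $T\vdash_L\varphi$ denotes derivability of $\varphi$ from a set of formulas $T$ in $L$. **Semantics.** An $\mathcal A$-evaluation $v$ maps $VAR$ to $A$ and is extended to formulas by interpreting $\&,\to,\bot$ as $*,\Rightarrow,0$. $T\models_{\mathcal A}\varphi$ means: every $\mathcal A$-evaluation $v$ with $v(\psi)=1$ for all $\psi\in T$ satisfies $v(\varphi)=1$. $L$ is strongly complete with respect to $\mathcal A$ if for every (possibly infinite) set $T$ of formulas and every formula $\varphi$: $T\vdash_L\varphi$ iff $T\models_{\mathcal A}\varphi$. **Hoops.** A hoop is $\langle A,*,\Rightarrow,1\rangle$ with $\langle A,*,1\rangle$ a commutative monoid and $x\Rightarrow x=1$, $x\Rightarrow(y\Rightarrow z)=(x*y)\Rightarrow z$, $x*(x\Rightarrow y)=y*(y\Rightarrow x)$; its order is $x\le y$ iff $x\Rightarrow y=1$. It is cancellative if $x=y\Rightarrow(x*y)$ holds. The standard cancellative hoop $(0,1]_C$ is $(0,1]$ with ordinary product and $x\Rightarrow y=\min(1,y/x)$. **Disconnected rotation.** For a cancellative hoop $\mathcal A$, let $A'=\{a':a\in A\}$ be a disjoint copy of $A$ with the inverse order, and $A^*=A\cup A'$ with $a'<b$ for all $a,b\in A$. Put $1=1_{\mathcal A}$, $0=1'$, $\sim a=a'$ and $\sim a'=a$ for $a\in A$; lattice operations come from the order. The product $a*b$ is: $a*_{\mathcal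 A}b$ if $a,b\in A$; $\sim(a\Rightarrow_{\mathcal A}\sim b)$ if $a\in A,b\in A'$; $\sim(b\Rightarrow_{\mathcal A}\sim a)$ if $a\in A',b\in A$; $0$ if $a,b\in A'$. The implication $a\Rightarrow b$ is: $a\Rightarrow_{\mathcal A}b$ if $a,b\in A$; $\sim(a*_{\mathcal A}\sim b)$ if $a\in A,b\in A'$; $1$ if $a\in A',b\in A$; $(\sim b)\Rightarrow_{\mathcal A}(\sim a)$ if $a,b\in A'$. The result $\mathcal A^*$ is the disconnected rotation of $\mathcal A$. Let $\mathcal V=((0,1]_C)^*$ (an MV-chain). **Ordinal sums.** Let $\langle I,\le\rangle$ be a totally ordered set with minimum $0$, and $(\mathcal A_i)_{i\in I}$ hoops with $A_i\cap A_j=\{1\}$ for $i\ne j$ (taking isomorphic copies if necessary) and $\mathcal A_0$ bounded (i.e. with a minimum). MV-algebras are used here through their $0$-free reducts. $\bigoplus_{i\in I}\mathcal A_i$ has universe $\bigcup_iA_i$, bottom $\min\mathcal A_0$, top $1$; operations inside a component are those of the component; if $x\in A_i\setminus\{1\}$, $y\in A_j$, $i<j$, then $x\Rightarrow y=1$ and $x*y=y*x=x$; if $x\in A_i$, $y\in A_j$, $i>j$, then $x\Rightarrow y=y$ (for $y\neq1$). $\omega\mathcal V$ is the ordinal sum, indexed by the natural numbers, of copies of $\mathcal V$. *)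

theory Defs
  imports Complex_Main "HOL-Algebra.Group"
begin

section \<open>Formulas and derivability\<close>

datatype fm =
    Var nat
  | Bot  (\<open>\<^bold>\<bottom>\<close>)
  | Conj fm fm  (infixl \<open>\<^bold>&\<close> 70)
  | Imp fm fm  (infixr \<open>\<^bold>\<rightarrow>\<close> 55)

definition WConj :: "fm \<Rightarrow> fm \<Rightarrow> fm"  (infixl \<open>\<^bold>\<and>\<close> 60) where
  "p \<^bold>\<and> q = p \<^bold>& (p \<^bold>\<rightarrow> q)"

definition Iff :: "fm \<Rightarrow> fm \<Rightarrow> fm"  (infix \<open>\<^bold>\<leftrightarrow>\<close> 50) where
  "p \<^bold>\<leftrightarrow> q = (p \<^bold>\<rightarrow> q) \<^bold>& (q \<^bold>\<rightarrow> p)"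

definition Sq :: "fm \<Rightarrow> fm" where
  "Sq p = p \<^bold>& p"

definition VeeBar :: "fm \<Rightarrow> fm \<Rightarrow> fm"  (infixl \<open>\<^bold>\<or>\<close> 60) where
  "p \<^bold>\<or> q = ((p \<^bold>\<rightarrow> p \<^bold>& q) \<^bold>\<rightarrow> q) \<^bold>\<and> ((q \<^bold>\<rightarrow> p \<^bold>& q) \<^bold>\<rightarrow> p)"

definition Twice :: "fm \<Rightarrow> fm" where
  "Twice p = p \<^bold>\<or> p"

text \<open>A logic is identified with its set of axioms; modus ponens is always the only rule.\<close>

inductive_set BL :: "fm set" where
  "(p \<^bold>\<rightarrow> q) \<^bold>\<rightarrow> ((q \<^bold>\<rightarrow> r) \<^bold>\<rightarrow> (p \<^bold>\<rightarrow> r)) \<in> BL"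
| "(p \<^bold>& q) \<^bold>\<rightarrow> p \<in> BL"
| "(p \<^bold>& q) \<^bold>\<rightarrow> (q \<^bold>& p) \<in> BL"
| "(p \<^bold>& (p \<^bold>\<rightarrow> q)) \<^bold>\<rightarrow> (q \<^bold>& (q \<^bold>\<rightarrow> p)) \<in> BL"
| "(p \<^bold>\<rightarrow> (q \<^bold>\<rightarrow> r)) \<^bold>\<rightarrow> ((p \<^bold>& q) \<^bold>\<rightarrow> r) \<in> BL"
| "((p \<^bold>& q) \<^bold>\<rightarrow> r) \<^bold>\<rightarrow> (p \<^bold>\<rightarrow> (q \<^bold>\<rightarrow> r)) \<in> BL"
| "((p \<^bold>\<rightarrow> q) \<^bold>\<rightarrow> r) \<^bold>\<rightarrow> (((q \<^bold>\<rightarrow> p) \<^bold>\<rightarrow> r) \<^bold>\<rightarrow> r) \<in> BL"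
| "\<^bold>\<bottom> \<^bold>\<rightarrow> p \<in> BL"

definition BL_Chang :: "fm set" where
  "BL_Chang = BL \<union> {Sq (Twice p) \<^bold>\<leftrightarrow> Twice (Sq p) | p. True}"

inductive derivable :: "fm set \<Rightarrow> fm set \<Rightarrow> fm \<Rightarrow> bool" for L T where
  ax: "p \<in> L \<Longrightarrow> derivable L T p"
| hyp: "p \<in> T \<Longrightarrow> derivable L T p"
| mp: "derivable L T p \<Longrightarrow> derivable L T (p \<^bold>\<rightarrow> q) \<Longrightarrow> derivable L T q"


section \<open>Hoops and BL-algebras\<close>

record 'a hoop = "'a monoid" +
  imp :: "'a \<Rightarrow> 'a \<Rightarrow> 'a"  (infixr \<open>\<leadsto>\<index>\<close> 65)

record 'a bounded_hoop = "'a hoop" +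
  zero :: 'a  (\<open>\<zero>\<index>\<close>)

definition hoop_order :: "('a, 'm) hoop_scheme \<Rightarrow> 'a gorder" where
  "hoop_order A = \<lparr>carrier = carrier A, eq = (=), le = (\<lambda>x y. x \<leadsto>\<^bsub>A\<^esub> y = \<one>\<^bsub>A\<^esub>)\<rparr>"

locale hoop = comm_monoid A for A (structure) +
  assumes imp_closed: "x \<in> carrier A \<Longrightarrow> y \<in> carrier A \<Longrightarrow> x \<leadsto> y \<in> carrier A"
    and imp_refl: "x \<in> carrier A \<Longrightarrow> x \<leadsto> x = \<one>"
    and imp_imp: "x \<in> carrier A \<Longrightarrow> y \<in> carrier A \<Longrightarrow> z \<in> carrier A \<Longrightarrow>
      x \<leadsto> (y \<leadsto> z) = (x \<otimes> y) \<leadsto> z"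
    and divisible: "x \<in> carrier A \<Longrightarrow> y \<in> carrier A \<Longrightarrow> x \<otimes> (x \<leadsto> y) = y \<otimes> (y \<leadsto> x)"

locale cancellative_hoop = hoop +
  assumes cancel: "x \<in> carrier A \<Longrightarrow> y \<in> carrier A \<Longrightarrow> x = y \<leadsto> (x \<otimes> y)"

text \<open>The lattice operations are not part of the record: residuation forces
  \<open>x \<le> y\<close> to mean \<open>x \<leadsto> y = \<one>\<close>, so meet and join are those of \<^const>\<open>hoop_order\<close>.\<close>

locale BL_algebra = comm_monoid A + bounded_lattice "hoop_order A" for A (structure) +
  assumes imp_closed: "x \<in> carrier A \<Longrightarrow> y \<in> carrier A \<Longrightarrow> x \<leadsto> y \<in> carrier A"
    and zero: "least (hoop_order A) \<zero> (carrier A)"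
    and one: "greatest (hoop_order A) \<one> (carrier A)"
    and residuation: "x \<in> carrier A \<Longrightarrow> y \<in> carrier A \<Longrightarrow> z \<in> carrier A \<Longrightarrow>
      z \<otimes> x \<sqsubseteq>\<^bsub>hoop_order A\<^esub> y \<longleftrightarrow> z \<sqsubseteq>\<^bsub>hoop_order A\<^esub> x \<leadsto> y"
    and prelinear: "x \<in> carrier A \<Longrightarrow> y \<in> carrier A \<Longrightarrow>
      (x \<leadsto> y) \<squnion>\<^bsub>hoop_order A\<^esub> (y \<leadsto> x) = \<one>"
    and BL_divisible: "x \<in> carrier A \<Longrightarrow> y \<in> carrier A \<Longrightarrow>
      x \<sqinter>\<^bsub>hoop_order A\<^esub> y = x \<otimes> (x \<leadsto> y)"

locale MV_algebra = BL_algebra +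
  assumes involutive: "x \<in> carrier A \<Longrightarrow> x = (x \<leadsto> \<zero>) \<leadsto> \<zero>"


section \<open>Semantics\<close>

primrec eval :: "('a, 'm) bounded_hoop_scheme \<Rightarrow> (nat \<Rightarrow> 'a) \<Rightarrow> fm \<Rightarrow> 'a" where
  "eval A v (Var n) = v n"
| "eval A v \<^bold>\<bottom> = \<zero>\<^bsub>A\<^esub>"
| "eval A v (p \<^bold>& q) = eval A v p \<otimes>\<^bsub>A\<^esub> eval A v q"
| "eval A v (p \<^bold>\<rightarrow> q) = eval A v p \<leadsto>\<^bsub>A\<^esub> eval A v q"

definition entails :: "('a, 'm) bounded_hoop_scheme \<Rightarrow> fm set \<Rightarrow> fm \<Rightarrow> bool" where
  "entails A T p \<longleftrightarrow> (\<forall>v. (\<forall>n. v n \<in> carrier A) \<longrightarrow>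
     (\<forall>q\<in>T. eval A v q = \<one>\<^bsub>A\<^esub>) \<longrightarrow> eval A v p = \<one>\<^bsub>A\<^esub>)"

definition strongly_complete :: "fm set \<Rightarrow> ('a, 'm) bounded_hoop_scheme \<Rightarrow> bool" where
  "strongly_complete L A \<longleftrightarrow> (\<forall>T p. derivable L T p \<longleftrightarrow> entails A T p)"


section \<open>Disconnected rotation\<close>

definition standard_cancellative_hoop :: "real hoop" where
  "standard_cancellative_hoop =
     \<lparr>carrier = {0<..1}, mult = (*), one = 1, imp = (\<lambda>x y. min 1 (y / x))\<rparr>"

text \<open>\<open>Inl a\<close> is the element \<open>a\<close> of the hoop and \<open>Inr a\<close> its copy \<open>a'\<close>.\<close>

fun rot_mult :: "('a, 'm) hoop_scheme \<Rightarrow> 'a + 'a \<Rightarrow> 'a + 'a \<Rightarrow> 'a + 'a" where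
  "rot_mult A (Inl a) (Inl b) = Inl (a \<otimes>\<^bsub>A\<^esub> b)"
| "rot_mult A (Inl a) (Inr b) = Inr (a \<leadsto>\<^bsub>A\<^esub> b)"
| "rot_mult A (Inr a) (Inl b) = Inr (b \<leadsto>\<^bsub>A\<^esub> a)"
| "rot_mult A (Inr a) (Inr b) = Inr \<one>\<^bsub>A\<^esub>"

fun rot_imp :: "('a, 'm) hoop_scheme \<Rightarrow> 'a + 'a \<Rightarrow> 'a + 'a \<Rightarrow> 'a + 'a" where
  "rot_imp A (Inl a) (Inl b) = Inl (a \<leadsto>\<^bsub>A\<^esub> b)"
| "rot_imp A (Inl a) (Inr b) = Inr (a \<otimes>\<^bsub>A\<^esub> b)"
| "rot_imp A (Inr a) (Inl b) = Inl \<one>\<^bsub>A\<^esub>"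
| "rot_imp A (Inr a) (Inr b) = Inl (b \<leadsto>\<^bsub>A\<^esub> a)"

definition disconnected_rotation :: "('a, 'm) hoop_scheme \<Rightarrow> ('a + 'a) bounded_hoop" where
  "disconnected_rotation A =
     \<lparr>carrier = carrier A <+> carrier A, mult = rot_mult A, one = Inl \<one>\<^bsub>A\<^esub>,
      imp = rot_imp A, zero = Inr \<one>\<^bsub>A\<^esub>\<rparr>"

definition V_alg :: "(real + real) bounded_hoop" where
  "V_alg = disconnected_rotation standard_cancellative_hoop"


section \<open>Ordinal sums\<close>

text \<open>
  The components are made to share exactly their top element: \<open>None\<close> is the common \<open>1\<close> and
  \<open>Some (i, a)\<close> is the element \<open>a \<noteq> 1\<close> of the \<open>i\<close>-th component. The index chain is a
  linearly ordered type, with \<open>bot\<close> as its minimum. A component enters only through its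
  hoop reduct, so the bottom of the sum is taken from the order of the first component.
\<close>

definition osum_in :: "('i \<Rightarrow> ('a, 'm) hoop_scheme) \<Rightarrow> 'i \<Rightarrow> 'a \<Rightarrow> ('i \<times> 'a) option" where
  "osum_in A i a = (if a = \<one>\<^bsub>A i\<^esub> then None else Some (i, a))"

fun osum_mult :: "('i::linorder \<Rightarrow> ('a, 'm) hoop_scheme) \<Rightarrow>
    ('i \<times> 'a) option \<Rightarrow> ('i \<times> 'a) option \<Rightarrow> ('i \<times> 'a) option" where
  "osum_mult A None y = y"
| "osum_mult A (Some x) None = Some x"
| "osum_mult A (Some (i, a)) (Some (j, b)) =
     (if i = j then osum_in A i (a \<otimes>\<^bsub>A i\<^esub> b)
      else if i < j then Some (i, a) else Some (j, b))"

fun osum_imp :: "('i::linorder \<Rightarrow> ('a, 'm) hoop_scheme) \<Rightarrow>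
    ('i \<times> 'a) option \<Rightarrow> ('i \<times> 'a) option \<Rightarrow> ('i \<times> 'a) option" where
  "osum_imp A None y = y"
| "osum_imp A (Some x) None = None"
| "osum_imp A (Some (i, a)) (Some (j, b)) =
     (if i = j then osum_in A i (a \<leadsto>\<^bsub>A i\<^esub> b)
      else if i < j then None else Some (j, b))"

definition ordinal_sum ::
    "('i::{linorder,order_bot} \<Rightarrow> ('a, 'm) hoop_scheme) \<Rightarrow> ('i \<times> 'a) option bounded_hoop" where
  "ordinal_sum A =
     \<lparr>carrier = (\<Union>i. osum_in A i ` carrier (A i)), mult = osum_mult A, one = None,
      imp = osum_imp A,
      zero = osum_in A bot (THE m. least (hoop_order (A bot)) m (carrier (A bot)))\<rparr>"

definition omega_V :: "(nat \<times> (real + real)) option bounded_hoop" where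
  "omega_V = ordinal_sum (\<lambda>_. V_alg)"


section \<open>Well-definedness\<close>

locale hoop_chain = hoop +
  assumes total: "x \<in> carrier A \<Longrightarrow> y \<in> carrier A \<Longrightarrow> x \<leadsto> y = \<one> \<or> y \<leadsto> x = \<one>"

context hoop begin

lemma one_imp: assumes "x \<in> carrier A" shows "\<one> \<leadsto> x = x"
  by (smt (verit) assms divisible imp_closed imp_imp imp_refl l_one m_comm one_closed r_one)

lemma imp_one: assumes "x \<in> carrier A" shows "x \<leadsto> \<one> = \<one>"
  by (smt (verit) assms divisible imp_closed imp_imp imp_refl l_one m_comm one_closed r_one one_imp)

lemma imp_antisym:
  assumes "x \<in> carrier A" "y \<in> carrier A" "x \<leadsto> y = \<one>" "y \<leadsto> x = \<one>" shows "x = y"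
  using assms divisible[of x y] by simp

lemma imp_trans:
  assumes "x \<in> carrier A" "y \<in> carrier A" "z \<in> carrier A" "x \<leadsto> y = \<one>" "y \<leadsto> z = \<one>"
  shows "x \<leadsto> z = \<one>"
proof -
  have "x = y \<otimes> (y \<leadsto> x)" using assms divisible[of x y] by simp
  then have "x \<leadsto> z = (y \<leadsto> x) \<leadsto> (y \<leadsto> z)"
    by (metis assms(1-3) imp_closed imp_imp m_comm)
  then show ?thesis using assms imp_one imp_closed by simp
qed

lemma partial_order_hoop: "partial_order (hoop_order A)"
  by unfold_locales
    (auto simp: hoop_order_def imp_refl intro: imp_antisym imp_trans)

end

sublocale hoop_chain \<subseteq> ord: total_order "hoop_order A"
  by (intro partial_order.total_orderI partial_order_hoop)
    (use total in \<open>auto simp: hoop_order_def\<close>)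

context hoop_chain begin

lemma le_iff: "x \<sqsubseteq>\<^bsub>hoop_order A\<^esub> y \<longleftrightarrow> x \<leadsto> y = \<one>"
  by (simp add: hoop_order_def)

lemma carrier_order: "carrier (hoop_order A) = carrier A"
  by (simp add: hoop_order_def)

lemma join_eq:
  assumes "x \<in> carrier A" "y \<in> carrier A" "x \<leadsto> y = \<one>"
  shows "x \<squnion>\<^bsub>hoop_order A\<^esub> y = y" "y \<squnion>\<^bsub>hoop_order A\<^esub> x = y"
  using assms ord.join_left ord.join_right ord.join_le ord.le_refl ord.le_antisym ord.join_closed
  unfolding le_iff carrier_order by metis+

lemma meet_eq:
  assumes "x \<in> carrier A" "y \<in> carrier A" "x \<leadsto> y = \<one>"
  shows "x \<sqinter>\<^bsub>hoop_order A\<^esub> y = x" "y \<sqinter>\<^bsub>hoop_order A\<^esub> x = x"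
  using assms ord.meet_left ord.meet_right ord.meet_le ord.le_refl ord.le_antisym ord.meet_closed
  unfolding le_iff carrier_order by metis+

end

lemma BL_algebraI:
  fixes A (structure)
  assumes "hoop_chain A" and zero: "least (hoop_order A) \<zero> (carrier A)"
  shows "BL_algebra A"
proof -
  interpret hoop_chain A by fact
  have one: "greatest (hoop_order A) \<one> (carrier A)"
    by (auto simp: greatest_def hoop_order_def imp_one)
  show ?thesis
  proof unfold_locales
    fix x y assume xy: "x \<in> carrier A" "y \<in> carrier A"
    show "(x \<leadsto> y) \<squnion>\<^bsub>hoop_order A\<^esub> (y \<leadsto> x) = \<one>"
      using total[OF xy] xy join_eq[OF _ one_closed imp_one] imp_closed by metis
    show "x \<sqinter>\<^bsub>hoop_order A\<^esub> y = x \<otimes> (x \<leadsto> y)"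
      using total[OF xy]
    proof
      assume "x \<leadsto> y = \<one>" then show ?thesis using xy meet_eq by simp
    next
      assume "y \<leadsto> x = \<one>" then show ?thesis using xy meet_eq divisible[OF xy] by simp
    qed
  qed (use zero one in \<open>auto simp: carrier_order le_iff imp_closed imp_imp\<close>)
qed

lemma standard_cancellative_hoop:
  "cancellative_hoop standard_cancellative_hoop" "hoop_chain standard_cancellative_hoop"
proof -
  have *: "hoop standard_cancellative_hoop"
    by unfold_locales
      (auto simp: standard_cancellative_hoop_def min_def field_simps mult_le_one
        mult_le_cancel_left1 intro: mult_le_one order_trans[OF mult_left_le_one_le])
  show "cancellative_hoop standard_cancellative_hoop"
    using * by (intro cancellative_hoop.intro cancellative_hoop_axioms.intro)
      (auto simp: standard_cancellative_hoop_def)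
  show "hoop_chain standard_cancellative_hoop"
    using * by (intro hoop_chain.intro hoop_chain_axioms.intro)
      (auto simp: standard_cancellative_hoop_def min_def field_simps)
qed

lemma disconnected_rotation_hoop_chain:
  fixes A (structure)
  assumes "cancellative_hoop A" "hoop_chain A"
  shows "hoop_chain (disconnected_rotation A)"
proof -
  interpret cancellative_hoop A by fact
  interpret hoop_chain A by fact
  have wajsberg_le: "(x \<leadsto> y) \<leadsto> y = (y \<leadsto> x) \<leadsto> x"
    if xy: "x \<in> carrier A" "y \<in> carrier A" "x \<leadsto> y = \<one>" for x y
  proof -
    have "x = y \<otimes> (y \<leadsto> x)" using xy divisible[of x y] by simp
    then have "(y \<leadsto> x) \<leadsto> x = y"
      using cancel[of y "y \<leadsto> x"] xy imp_closed by simp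
    then show ?thesis using xy one_imp by simp
  qed
  have wajsberg: "(x \<leadsto> y) \<leadsto> y = (y \<leadsto> x) \<leadsto> x"
    if xy: "x \<in> carrier A" "y \<in> carrier A" for x y
    using total[OF xy] wajsberg_le xy by metis
  have cancel': "y \<leadsto> (x \<otimes> y) = x" "y \<leadsto> (y \<otimes> x) = x"
    if "x \<in> carrier A" "y \<in> carrier A" for x y
    using cancel[of x y] that by (auto simp: m_comm)
  have c: "comm_monoid (disconnected_rotation A)"
  proof (rule comm_monoidI)
    fix x y z
    assume "x \<in> carrier (disconnected_rotation A)" "y \<in> carrier (disconnected_rotation A)"
      "z \<in> carrier (disconnected_rotation A)"
    then show "x \<otimes>\<^bsub>disconnected_rotation A\<^esub> y \<otimes>\<^bsub>disconnected_rotation A\<^esub> z =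
      x \<otimes>\<^bsub>disconnected_rotation A\<^esub> (y \<otimes>\<^bsub>disconnected_rotation A\<^esub> z)"
      by (auto simp: disconnected_rotation_def imp_closed m_assoc imp_imp imp_one imp_refl)
        (simp_all add: m_comm)
  qed (auto simp: disconnected_rotation_def imp_closed one_imp m_comm)
  show ?thesis
  proof (intro hoop_chain.intro hoop.intro c hoop_axioms.intro hoop_chain_axioms.intro)
    fix x y z
    assume "x \<in> carrier (disconnected_rotation A)" "y \<in> carrier (disconnected_rotation A)"
      "z \<in> carrier (disconnected_rotation A)"
    then show "x \<leadsto>\<^bsub>disconnected_rotation A\<^esub> (y \<leadsto>\<^bsub>disconnected_rotation A\<^esub> z) =
      (x \<otimes>\<^bsub>disconnected_rotation A\<^esub> y) \<leadsto>\<^bsub>disconnected_rotation A\<^esub> z"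
      by (auto simp: disconnected_rotation_def imp_closed m_assoc imp_imp imp_one imp_refl)
        (simp_all add: m_comm)
  qed (auto simp: disconnected_rotation_def imp_closed imp_refl imp_one divisible one_imp
      cancel' wajsberg dest: total)
qed

lemma hoop_chain_V_alg: "hoop_chain V_alg"
  unfolding V_alg_def
  by (intro disconnected_rotation_hoop_chain standard_cancellative_hoop)

lemma least_V_alg: "least (hoop_order V_alg) \<zero>\<^bsub>V_alg\<^esub> (carrier V_alg)"
  by (auto simp: least_def hoop_order_def V_alg_def disconnected_rotation_def
      standard_cancellative_hoop_def)

lemma MV_algebra_V_alg: "MV_algebra V_alg"
  by (intro MV_algebra.intro BL_algebraI hoop_chain_V_alg least_V_alg MV_algebra_axioms.intro)
    (auto simp: V_alg_def disconnected_rotation_def standard_cancellative_hoop_def)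

lemma carrier_ordinal_sum_cases:
  assumes "x \<in> carrier (ordinal_sum A)"
  obtains "x = None" | i a where "x = Some (i, a)" "a \<in> carrier (A i)" "a \<noteq> \<one>\<^bsub>A i\<^esub>"
  using assms by (auto simp: ordinal_sum_def osum_in_def split: if_splits)

lemma ordinal_sum_hoop_chain:
  assumes "\<And>i. hoop_chain (A i)"
  shows "hoop_chain (ordinal_sum A)"
proof -
  interpret hoop_chain "A i" for i by fact
  note [simp] = imp_closed imp_refl imp_imp imp_one one_imp ordinal_sum_def osum_in_def
  have None_in: "None \<in> carrier (ordinal_sum A)"
    using one_closed[of undefined] by force
  have Some_in: "Some (i, a) \<in> carrier (ordinal_sum A) \<longleftrightarrow> a \<in> carrier (A i) \<and> a \<noteq> \<one>\<^bsub>A i\<^esub>" for i a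
    by (auto split: if_splits)
  have mult_ne: "a \<otimes>\<^bsub>A i\<^esub> b \<noteq> \<one>\<^bsub>A i\<^esub>"
    if "a \<in> carrier (A i)" "b \<in> carrier (A i)" "a \<noteq> \<one>\<^bsub>A i\<^esub>" for i a b
    using that by (metis imp_imp imp_one imp_refl m_comm one_imp)
  have mult_ne': "a \<otimes>\<^bsub>A i\<^esub> b \<noteq> \<one>\<^bsub>A i\<^esub>"
    if "a \<in> carrier (A i)" "b \<in> carrier (A i)" "b \<noteq> \<one>\<^bsub>A i\<^esub>" for i a b
    using that mult_ne m_comm by metis
  have ac: "a \<otimes>\<^bsub>A i\<^esub> b = b \<otimes>\<^bsub>A i\<^esub> a"
    if "a \<in> carrier (A i)" "b \<in> carrier (A i)" for i a b
    using that m_comm by metis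
  have anti: "a = b"
    if "a \<in> carrier (A i)" "b \<in> carrier (A i)" "a \<leadsto>\<^bsub>A i\<^esub> b = \<one>\<^bsub>A i\<^esub>" "b \<leadsto>\<^bsub>A i\<^esub> a = \<one>\<^bsub>A i\<^esub>" for i a b
    using that imp_antisym by metis
  have div1: "a \<otimes>\<^bsub>A i\<^esub> (a \<leadsto>\<^bsub>A i\<^esub> b) = b"
    if "a \<in> carrier (A i)" "b \<in> carrier (A i)" "b \<leadsto>\<^bsub>A i\<^esub> a = \<one>\<^bsub>A i\<^esub>" for i a b
    using that divisible[of a i b] by simp
  have c: "comm_monoid (ordinal_sum A)"
  proof (rule comm_monoidI)
    fix x y
    assume "x \<in> carrier (ordinal_sum A)" "y \<in> carrier (ordinal_sum A)"
    then show "x \<otimes>\<^bsub>ordinal_sum A\<^esub> y \<in> carrier (ordinal_sum A)"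
      by (elim carrier_ordinal_sum_cases; simp only: Some_in None_in)
        (use None_in Some_in in \<open>auto split: if_splits simp: mult_ne\<close>)
    show "x \<otimes>\<^bsub>ordinal_sum A\<^esub> y = y \<otimes>\<^bsub>ordinal_sum A\<^esub> x"
      using \<open>x \<in> _\<close> \<open>y \<in> _\<close> by (elim carrier_ordinal_sum_cases) (auto simp: ac)
  next
    fix x y z
    assume "x \<in> carrier (ordinal_sum A)" "y \<in> carrier (ordinal_sum A)"
      "z \<in> carrier (ordinal_sum A)"
    then show "x \<otimes>\<^bsub>ordinal_sum A\<^esub> y \<otimes>\<^bsub>ordinal_sum A\<^esub> z =
        x \<otimes>\<^bsub>ordinal_sum A\<^esub> (y \<otimes>\<^bsub>ordinal_sum A\<^esub> z)"
      by (elim carrier_ordinal_sum_cases) (auto simp: mult_ne mult_ne' m_assoc)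
  qed (use None_in in auto)
  show ?thesis
  proof (intro hoop_chain.intro hoop.intro c hoop_axioms.intro hoop_chain_axioms.intro)
    fix x y
    assume "x \<in> carrier (ordinal_sum A)" "y \<in> carrier (ordinal_sum A)"
    then show "x \<leadsto>\<^bsub>ordinal_sum A\<^esub> y \<in> carrier (ordinal_sum A)"
      by (elim carrier_ordinal_sum_cases; simp only: Some_in None_in)
        (use None_in Some_in in \<open>auto split: if_splits\<close>)
    show "x \<leadsto>\<^bsub>ordinal_sum A\<^esub> y = \<one>\<^bsub>ordinal_sum A\<^esub> \<or> y \<leadsto>\<^bsub>ordinal_sum A\<^esub> x = \<one>\<^bsub>ordinal_sum A\<^esub>"
      using \<open>x \<in> _\<close> \<open>y \<in> _\<close> by (elim carrier_ordinal_sum_cases) (auto dest: total)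
    show "x \<otimes>\<^bsub>ordinal_sum A\<^esub> (x \<leadsto>\<^bsub>ordinal_sum A\<^esub> y) = y \<otimes>\<^bsub>ordinal_sum A\<^esub> (y \<leadsto>\<^bsub>ordinal_sum A\<^esub> x)"
      using \<open>x \<in> _\<close> \<open>y \<in> _\<close> by (elim carrier_ordinal_sum_cases)
        (auto simp: div1 mult_ne mult_ne' dest: anti total)
  next
    fix x y z
    assume "x \<in> carrier (ordinal_sum A)" "y \<in> carrier (ordinal_sum A)"
      "z \<in> carrier (ordinal_sum A)"
    then show "x \<leadsto>\<^bsub>ordinal_sum A\<^esub> (y \<leadsto>\<^bsub>ordinal_sum A\<^esub> z) =
      (x \<otimes>\<^bsub>ordinal_sum A\<^esub> y) \<leadsto>\<^bsub>ordinal_sum A\<^esub> z"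
      by (elim carrier_ordinal_sum_cases) 
       (auto simp: mult_ne mult_ne' simp flip: imp_imp)
  qed (auto elim!: carrier_ordinal_sum_cases)
qed

lemma zero_omega_V: "\<zero>\<^bsub>omega_V\<^esub> = Some (0, Inr 1)"
proof -
  interpret hoop_chain V_alg by (rule hoop_chain_V_alg)
  have "(THE m. least (hoop_order V_alg) m (carrier V_alg)) = \<zero>\<^bsub>V_alg\<^esub>"
  proof (rule the_equality, rule least_V_alg)
    fix m assume "least (hoop_order V_alg) m (carrier V_alg)"
    then show "m = \<zero>\<^bsub>V_alg\<^esub>"
      using least_V_alg unfolding least_def hoop_order_def by (auto intro: imp_antisym)
  qed
  then have "\<zero>\<^bsub>omega_V\<^esub> = osum_in (\<lambda>_. V_alg) 0 \<zero>\<^bsub>V_alg\<^esub>"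
    by (simp add: omega_V_def ordinal_sum_def bot_nat_def)
  then show ?thesis
    by (simp add: osum_in_def V_alg_def disconnected_rotation_def standard_cancellative_hoop_def)
qed

lemma BL_algebra_omega_V: "BL_algebra omega_V"
proof (rule BL_algebraI)
  show "hoop_chain omega_V"
    unfolding omega_V_def by (intro ordinal_sum_hoop_chain hoop_chain_V_alg)
  have "Some (0, Inr 1) \<in> carrier omega_V"
    by (force simp: omega_V_def ordinal_sum_def osum_in_def V_alg_def disconnected_rotation_def
        standard_cancellative_hoop_def)
  then show "least (hoop_order omega_V) \<zero>\<^bsub>omega_V\<^esub> (carrier omega_V)"
    unfolding zero_omega_V
    by (auto simp: least_def hoop_order_def omega_V_def elim!: carrier_ordinal_sum_cases)
      (auto simp: ordinal_sum_def osum_in_def V_alg_def disconnected_rotation_def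
        standard_cancellative_hoop_def)
qed

end

theory Submission
  imports Defs
begin

text \<open>
  Derivations are finite, so strong completeness with respect to an algebra makes the consequence
  relation of that algebra compact. The proof shows that \<open>\<Turnstile>\<close> over \<open>\<omega>\<V>\<close> is not compact, because
  the standard cancellative hoop is Archimedean: if \<open>0 < y \<le> x\<^sup>n\<close> for all \<open>n\<close> and \<open>x \<le> 1\<close>, then
  \<open>x = 1\<close>. Hence the infinitely many formulas \<open>y \<rightarrow> x\<^sup>n\<close> should entail \<open>y \<rightarrow> x & y\<close>, whereas
  finitely many of them do not, as one sees by taking \<open>y\<close> to be a high power of \<open>x = 1/2\<close>.

  The conclusion is \<open>y \<rightarrow> x & y\<close>, and not \<open>x\<close>, since \<open>x\<close> may lie in a higher component of the
  ordinal sum than \<open>y\<close>; in that case \<open>x & y = y\<close>. One further obstacle is that \<open>y\<close> may lie in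
  the rotated half of a component, below all powers of every \<open>x\<close> in the upper half. The premise
  \<open>(y \<rightarrow> y & y) \<rightarrow> y\<close> excludes this: it has the value \<open>1\<close> on the upper half, where
  \<open>y \<rightarrow> y & y = y\<close> by cancellation, and a value in the lower half when \<open>y\<close> is there.
\<close>

lemma derivable_mono:
  assumes "derivable L T p" "T \<subseteq> T'"
  shows "derivable L T' p"
  using assms by induction (auto intro: derivable.intros)

lemma derivable_finite:
  assumes "derivable L T p"
  shows "\<exists>T0\<subseteq>T. finite T0 \<and> derivable L T0 p"
  using assms
proof induction
  case (ax p)
  then show ?case by (intro exI[of _ "{}"]) (auto intro: derivable.ax)
next
  case (hyp p)
  then show ?case by (intro exI[of _ "{p}"]) (auto intro: derivable.hyp)
next
  case (mp p q)
  then obtain T1 T2 where *: "T1 \<subseteq> T" "finite T1" "derivable L T1 p"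
    "T2 \<subseteq> T" "finite T2" "derivable L T2 (p \<^bold>\<rightarrow> q)" by blast
  then have "derivable L (T1 \<union> T2) q"
    by (blast intro: derivable.mp derivable_mono)
  with * show ?case by (intro exI[of _ "T1 \<union> T2"]) auto
qed

lemma strongly_complete_compact:
  assumes "strongly_complete L A" "entails A T p"
  shows "\<exists>T0\<subseteq>T. finite T0 \<and> entails A T0 p"
  using assms derivable_finite[of L T p] unfolding strongly_complete_def by blast

text \<open>The exponent is shifted by one because the language has no constant for the empty product.\<close>

primrec conj_power :: "fm \<Rightarrow> nat \<Rightarrow> fm" where
  "conj_power p 0 = p"
| "conj_power p (Suc n) = conj_power p n \<^bold>& p"

definition arch_premises :: "fm \<Rightarrow> fm \<Rightarrow> fm set" where
  "arch_premises x y =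
     insert ((y \<^bold>\<rightarrow> y \<^bold>& y) \<^bold>\<rightarrow> y) (range (\<lambda>n. y \<^bold>\<rightarrow> conj_power x n))"

lemmas omega_V_unfold = omega_V_def ordinal_sum_def osum_in_def V_alg_def
  disconnected_rotation_def standard_cancellative_hoop_def

lemma carrier_omega_V_cases:
  assumes "u \<in> carrier omega_V"
  obtains (one) "u = None"
  | (upper) i a where "u = Some (i, Inl a)" "0 < a" "a < 1"
  | (lower) i a where "u = Some (i, Inr a)" "0 < a" "a \<le> 1"
  using assms by (force simp: omega_V_unfold split: if_splits)

lemma upper_in_omega_V:
  assumes "0 < a" "a < 1"
  shows "Some (i, Inl a) \<in> carrier omega_V"
  using assms by (force simp: omega_V_unfold)

lemma eval_conj_power_upper:
  assumes "eval omega_V v p = Some (i, Inl a)" "0 < a" "a < 1"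
  shows "eval omega_V v (conj_power p n) = Some (i, Inl (a ^ Suc n))"
proof (induction n)
  case (Suc n)
  have "a ^ n * a * a \<noteq> 1"
    using assms power_Suc_less_one[of a "Suc n"] by (simp add: mult_ac)
  with Suc assms show ?case by (simp add: omega_V_unfold mult_ac)
qed (use assms in simp)

text \<open>The Archimedean property of the real numbers, transferred to \<open>\<omega>\<V>\<close>.\<close>

lemma arch_premises_entail:
  "entails omega_V (arch_premises (Var x) (Var y)) (Var y \<^bold>\<rightarrow> Var x \<^bold>& Var y)"
  unfolding entails_def
proof (intro allI impI)
  fix v :: "nat \<Rightarrow> (nat \<times> (real + real)) option"
  assume v: "\<forall>n. v n \<in> carrier omega_V"
    and T: "\<forall>q\<in>arch_premises (Var x) (Var y). eval omega_V v q = \<one>\<^bsub>omega_V\<^esub>"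
  have not_lower: "eval omega_V v ((Var y \<^bold>\<rightarrow> Var y \<^bold>& Var y) \<^bold>\<rightarrow> Var y) = None"
    and powers: "eval omega_V v (Var y \<^bold>\<rightarrow> conj_power (Var x) n) = None" for n
    using T by (auto simp: arch_premises_def omega_V_unfold simp del: eval.simps)
  have vx: "v x \<in> carrier omega_V" and vy: "v y \<in> carrier omega_V" using v by auto
  have le: "osum_imp (\<lambda>_. V_alg) (v y) (v x) = None"
    using powers[of 0] by (simp add: omega_V_def ordinal_sum_def)
  from vy have "eval omega_V v (Var y \<^bold>\<rightarrow> Var x \<^bold>& Var y) = None"
  proof (cases rule: carrier_omega_V_cases)
    case one
    then show ?thesis using le by (simp add: omega_V_unfold)
  next
    case (lower i a)
    then show ?thesis using not_lower by (auto simp: omega_V_unfold split: if_splits)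
  next
    case y: (upper i a)
    from vx show ?thesis
    proof (cases rule: carrier_omega_V_cases)
      case one
      then show ?thesis using y by (simp add: omega_V_unfold)
    next
      case (lower j b)
      then show ?thesis using y le by (auto simp: omega_V_unfold split: if_splits)
    next
      case x: (upper j b)
      consider "j < i" | "i < j" | "j = i" by linarith
      then show ?thesis
      proof cases
        case 1
        then show ?thesis using x y le by (auto simp: omega_V_unfold)
      next
        case 2
        then show ?thesis using x y by (auto simp: omega_V_unfold)
      next
        case 3
        obtain n where "b ^ n < a" using real_arch_pow_inv[of a b] x y by auto
        then have "b ^ Suc n < a"
          using x power_decreasing[of n "Suc n" b] by linarith
        moreover have "a \<le> b ^ Suc n"
          using powers[of n] eval_conj_power_upper[of v "Var x" j b n] x y 3
          by (auto simp: omega_V_unfold min_def field_simps split: if_splits)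
        ultimately show ?thesis by simp
      qed
    qed
  qed
  then show "eval omega_V v (Var y \<^bold>\<rightarrow> Var x \<^bold>& Var y) = \<one>\<^bsub>omega_V\<^esub>"
    by (simp add: omega_V_def ordinal_sum_def)
qed

text \<open>
  Only finitely many powers of \<open>x\<close> are bounded from below, so \<open>y\<close> can be chosen as a larger power
  of \<open>x < 1\<close> inside the upper half of one component, where multiplication by \<open>x\<close> is strictly
  decreasing.
\<close>

lemma finite_arch_premises_not_entail:
  assumes "x \<noteq> y" "finite T0" "T0 \<subseteq> arch_premises (Var x) (Var y)"
  shows "\<not> entails omega_V T0 (Var y \<^bold>\<rightarrow> Var x \<^bold>& Var y)"
proof
  let ?d = "(Var y \<^bold>\<rightarrow> Var y \<^bold>& Var y) \<^bold>\<rightarrow> Var y"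
  let ?f = "\<lambda>n. Var y \<^bold>\<rightarrow> conj_power (Var x) n"
  assume ent: "entails omega_V T0 (Var y \<^bold>\<rightarrow> Var x \<^bold>& Var y)"
  have "T0 - {?d} \<subseteq> range ?f" using assms(3) by (auto simp: arch_premises_def)
  then obtain C where C: "finite C" "T0 - {?d} = ?f ` C"
    using finite_subset_image[of "T0 - {?d}" ?f UNIV] assms(2) by auto
  then obtain N where N: "n < N" if "n \<in> C" for n
    using finite_nat_set_iff_bounded[of C] by blast
  define a :: real where "a = (1/2) ^ Suc N"
  have a: "0 < a" "a < 1"
    using power_Suc_less_one[of "1/2 :: real" N] by (auto simp: a_def)
  define v :: "nat \<Rightarrow> (nat \<times> (real + real)) option"
    where "v = (\<lambda>n. if n = y then Some (0, Inl a) else Some (0, Inl (1/2)))"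
  have "v n \<in> carrier omega_V" for n
    using a upper_in_omega_V by (simp add: v_def)
  moreover have "eval omega_V v q = \<one>\<^bsub>omega_V\<^esub>" if "q \<in> T0" for q
  proof (cases "q = ?d")
    case True
    have "a * a \<noteq> 1" using a mult_strict_mono[of a 1 a 1] by simp
    with True a show ?thesis by (simp add: v_def omega_V_unfold)
  next
    case False
    with that C N obtain n where n: "q = ?f n" "n < N" by blast
    have "eval omega_V v (conj_power (Var x) n) = Some (0, Inl ((1/2) ^ Suc n))"
      by (rule eval_conj_power_upper) (use assms(1) in \<open>auto simp: v_def\<close>)
    moreover have "a \<le> (1/2) ^ Suc n"
      unfolding a_def using n by (intro power_decreasing) auto
    ultimately show ?thesis
      using a n by (simp add: v_def omega_V_unfold min_def field_simps)
  qed
  ultimately have "eval omega_V v (Var y \<^bold>\<rightarrow> Var x \<^bold>& Var y) = \<one>\<^bsub>omega_V\<^esub>"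
    using ent unfolding entails_def by blast
  moreover have "eval omega_V v (Var y \<^bold>\<rightarrow> Var x \<^bold>& Var y) = Some (0, Inl (1/2))"
    using a assms(1) by (simp add: v_def omega_V_unfold)
  ultimately show False by (simp add: omega_V_def ordinal_sum_def)
qed

theorem theorem3p10:
  shows "\<not> strongly_complete BL_Chang omega_V"
proof
  assume "strongly_complete BL_Chang omega_V"
  from strongly_complete_compact[OF this arch_premises_entail[of 0 1]]
  show False using finite_arch_premises_not_entail[of 0 1] by auto
qed

end
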